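(* Let $P(x)=c_{\nu}x^{\nu}+\cdots+c_1x\in\mathbb{Z}[x]$ with $(c_\nu,\ldots,c_1)$ a non-zero integer vector. For each integer $Q$ let $\mathcal{B}_Q$ be a fixed subset of the primes $\le Q$, and let $\mathscr{M}_{\mathcal{B}_Q,P}=\{a/p: 1\leq a\leq p\leq Q,\ \gcd(P(a),p)=1,\ p\in\mathcal{B}_Q\}$. Then the limiting pair correlation of $(\mathscr{M}_{\mathcal{B}_Q,P})_{Q\ge1}$ exists and is Poissonian (i.e. $\lim_{Q\to\infty}\mathcal{S}_{\mathscr{M}_{\mathcal{B}_Q,P}}(\Lambda)=\Lambda$ for every $\Lambda>0$) if and only if $\sum_{p\in\mathcal{B}_Q}p^2=o\big((\#\mathscr{M}_{\mathcal{B}_Q,P})^2\big)$ as $Q\to\infty$.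
   Context: For a finite set $F\subset[0,1]$ with $\mathcal{N}=\#F$ and $\Lambda>0$, $\mathcal{S}_F(\Lambda)=\frac{1}{\mathcal N}\#\{(a,b)\in F^2: a\ne b,\ a-b\in\frac{1}{\mathcal N}(0,\Lambda)+\mathbb{Z}\}$. *)

theory Defs
  imports Complex_Main
    "HOL-Library.Landau_Symbols"
    "HOL-Computational_Algebra.Primes"
    "HOL-Computational_Algebra.Polynomial"
begin

(* Meant for finite nonempty F; for empty F, division by zero makes the value 0. *)
definition pair_corr :: "real set \<Rightarrow> real \<Rightarrow> real" where
  "pair_corr F \<Lambda> =
     1 / real (card F) *
     real (card {(a, b). a \<in> F \<and> b \<in> F \<and> a \<noteq> b \<and>
                   (\<exists>t \<in> {0<..<\<Lambda>}. \<exists>k::int. a - b = 1 / real (card F) * t + of_int k)})"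

definition poissonian_pair_corr :: "(nat \<Rightarrow> real set) \<Rightarrow> bool" where
  "poissonian_pair_corr F \<longleftrightarrow>
     (\<forall>\<Lambda>::real. \<Lambda> > 0 \<longrightarrow> (\<lambda>Q. pair_corr (F Q) \<Lambda>) \<longlonglongrightarrow> \<Lambda>)"

definition prime_fractions :: "nat \<Rightarrow> nat set \<Rightarrow> int poly \<Rightarrow> real set" where
  "prime_fractions Q B P =
     {real a / real p | a p::nat. 1 \<le> a \<and> a \<le> p \<and> p \<le> Q \<and>
        gcd (poly P (int a)) (int p) = 1 \<and> p \<in> B}"

end

theory Submission
  imports Defs
begin

text \<open>
  Write \<open>N\<close> for the number of fractions, \<open>g\<^sub>p\<close> for the number of those with denominator \<open>p\<close>,
  and \<open>\<delta> = \<Lambda> / N\<close>. For \<open>p \<noteq> q\<close> the numerators \<open>aq - bp\<close> run once through the residues modulo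
  \<open>pq\<close>, and only boundedly many residues are removed modulo each prime, so inclusion-exclusion
  gives \<open>\<delta> g\<^sub>p g\<^sub>q + O(1)\<close> pairs at distance in \<open>(0, \<delta>)\<close>. Summing over \<open>p \<noteq> q\<close>, the error
  is quadratic in the number of denominators, hence \<open>o(N)\<close> because the primes have density zero.
  So the pair correlation is \<open>\<Lambda> - \<Lambda> (\<Sum>g\<^sub>p\<^sup>2) / N\<^sup>2\<close> plus the contribution of pairs with equal
  denominators plus \<open>o(1)\<close>. That contribution is at most \<open>\<Lambda> (\<Sum>p\<^sup>2) / N\<^sup>2\<close>, which gives one direction;
  for \<open>\<Lambda> = 1/2\<close> it vanishes, since \<open>p \<le> 2 N\<close>, which gives the other.
\<close>


section \<open>Sparsity of the primes\<close>

lemma prod_primes_dvd: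
  fixes n :: nat
  assumes "finite A" "\<And>p. p \<in> A \<Longrightarrow> prime p" "\<And>p. p \<in> A \<Longrightarrow> p dvd n"
  shows "\<Prod>A dvd n"
  using assms
proof (induction A)
  case (insert p A)
  have "coprime p (\<Prod>A)"
    using insert by (intro prod_coprime_right) (metis insertCI primes_coprime)
  thus ?case using insert by (simp add: divides_mult)
qed simp

text \<open>Each of these primes divides \<open>(2n)!\<close> but not \<open>n!\<close>, hence the
  central binomial coefficient, and so does their product. That coefficient is at most
  \<open>4 ^ n\<close>, while every factor of the product exceeds \<open>4 ^ m\<close>; comparing
  exponents gives the bound.\<close>

lemma card_primes_dyadic:
  assumes "4 ^ m \<le> n"
  shows "m * card {p. prime p \<and> n < p \<and> p \<le> 2 * n} \<le> n"
proof -
  let ?S = "{p::nat. prime p \<and> n < p \<and> p \<le> 2 * n}"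
  have fin: "finite ?S" by (rule finite_subset[of _ "{..2*n}"]) auto
  have dvd1: "p dvd (2 * n) choose n" if "p \<in> ?S" for p
  proof -
    from that have p: "prime p" "n < p" "p \<le> 2 * n" by auto
    have "fact n * fact (2 * n - n) * ((2 * n) choose n) = (fact (2 * n) :: nat)"
      by (rule binomial_fact_lemma) simp
    moreover have "p dvd fact (2 * n)" using p by (simp add: prime_dvd_fact_iff)
    ultimately have "p dvd fact n * fact n * ((2 * n) choose n)" by simp
    moreover have "\<not> p dvd fact n" using p by (simp add: prime_dvd_fact_iff)
    ultimately show ?thesis using p by (simp add: prime_dvd_mult_iff)
  qed
  have "\<Prod>?S dvd (2 * n) choose n"
    using dvd1 by (intro prod_primes_dvd fin) auto
  moreover have "(2 * n) choose n > 0" by simp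
  ultimately have le: "\<Prod>?S \<le> (2 * n) choose n" by (simp add: dvd_imp_le)
  have "(4::nat) ^ (m * card ?S) = (\<Prod>p\<in>?S. 4 ^ m)" by (simp add: power_mult)
  also have "\<dots> \<le> \<Prod>?S" using assms by (intro prod_mono) auto
  also have "\<dots> \<le> 2 ^ (2 * n)" using le binomial_le_pow2[of "2 * n" n] by linarith
  also have "\<dots> = 4 ^ n" by (simp add: power_mult)
  finally show ?thesis by (simp add: power_increasing_iff)
qed

text \<open>This is density zero in explicit form, as \<open>m\<close> is arbitrary. The proof
  halves \<open>x\<close> repeatedly and charges each upper half to the dyadic bound, until
  \<open>x\<close> drops below \<open>2 * 4 ^ m\<close>, where the trivial bound suffices.\<close>

lemma card_primes_le:
  assumes "m > 0"
  shows "real (card {p. prime p \<and> p \<le> x}) \<le> 2 * real x / real m + 2 * 4 ^ m"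
proof (induction x rule: less_induct)
  case (less x)
  define f where "f x = card {p::nat. prime p \<and> p \<le> x}" for x
  have fin: "finite {p::nat. prime p \<and> p \<le> x}" for x
    by (rule finite_subset[of _ "{..x}"]) auto
  show ?case
  proof (cases "x < 2 * 4 ^ m")
    case True
    have "card {p::nat. prime p \<and> p \<le> x} \<le> card {1..x}"
      by (rule card_mono) (auto simp: prime_ge_Suc_0_nat)
    hence "real (card {p::nat. prime p \<and> p \<le> x}) \<le> real x" by simp
    also have "\<dots> \<le> real (2 * 4 ^ m)" using True by (simp only: of_nat_le_iff)
    finally show ?thesis by (simp add: add_increasing)
  next
    case False
    \<comment> \<open>Rounding up guarantees that the range up to \<open>2 * n\<close> covers
      \<open>x\<close>.\<close>
    define n where "n = (x + 1) div 2"
    have "(4::nat) ^ m \<ge> 4 ^ 1" using assms by (intro power_increasing) auto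
    hence x8: "x \<ge> 8" using False by simp
    have n: "4 ^ m \<le> n" "x \<le> 2 * n" "2 * n \<le> x + 1" "n < x"
      using False x8 unfolding n_def by linarith+
    have "f x \<le> f (2 * n)" unfolding f_def by (intro card_mono fin) (use n in auto)
    also have "\<dots> = card ({p. prime p \<and> p \<le> n} \<union> {p. prime p \<and> n < p \<and> p \<le> 2 * n})"
      unfolding f_def by (rule arg_cong[of _ _ card]) auto
    also have "\<dots> \<le> f n + card {p. prime p \<and> n < p \<and> p \<le> 2 * n}"
      unfolding f_def by (rule card_Un_le)
    finally have 1: "real (f x) \<le> real (f n) + real (card {p. prime p \<and> n < p \<and> p \<le> 2 * n})" by linarith
    have "real m * real (card {p. prime p \<and> n < p \<and> p \<le> 2 * n}) \<le> real n"
      using card_primes_dyadic[OF n(1)] by (metis of_nat_le_iff of_nat_mult)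
    hence 2: "real (card {p. prime p \<and> n < p \<and> p \<le> 2 * n}) \<le> real n / real m"
      using assms by (simp add: field_simps)
    have 3: "real (f n) \<le> 2 * real n / real m + 2 * 4 ^ m"
      unfolding f_def by (rule less.IH[OF n(4)])
    \<comment> \<open>The induction hypothesis costs \<open>2 * n / m\<close> and the dyadic block
      \<open>n / m\<close>; this inequality lets the total \<open>3 * n / m\<close> fit into
      \<open>2 * x / m\<close>.\<close>
    have "3 * real n \<le> 2 * real x" using n(3) x8 by linarith
    hence "3 * real n / real m \<le> 2 * real x / real m" using assms by (intro divide_right_mono) auto
    thus ?thesis using 1 2 3 unfolding f_def
      by (simp add: add_divide_distrib[symmetric])
  qed
qed

text \<open>Of \<open>k\<close> primes only about half can lie below a large multiple
  \<open>m * k\<close>, since primes are sparse. The others each contribute more than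
  \<open>m * k\<close> to the sum, so the sum is at least about \<open>m * k^2 / 2\<close>, and
  \<open>m\<close> may be taken as large as desired.\<close>

lemma card_prime_set_squared_le:
  assumes "\<epsilon> > 0"
  obtains K :: real where
    "\<And>A. finite A \<Longrightarrow> (\<And>p. p \<in> A \<Longrightarrow> prime p) \<Longrightarrow>
       (real (card A))\<^sup>2 \<le> \<epsilon> * (\<Sum>p\<in>A. real p) + K"
proof -
  define m where "m = nat \<lceil>4 / \<epsilon>\<rceil> + 1"
  have "4 / \<epsilon> < real m" unfolding m_def by linarith
  moreover have "m > 0" by (simp add: m_def)
  ultimately have m: "m > 0" "4 / real m < \<epsilon>" using assms by (simp_all add: divide_less_eq mult.commute)
  define K where "K = (2::real) * 4 ^ (4 * m)"
  show ?thesis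
  proof (rule that[of "4 * K\<^sup>2"])
    fix A :: "nat set" assume A: "finite A" "\<And>p. p \<in> A \<Longrightarrow> prime p"
    let ?k = "real (card A)" and ?S = "\<Sum>p\<in>A. real p"
    \<comment> \<open>At this level the prime count with parameter \<open>4 * m\<close> has main
      term \<open>2 * y / (4 * m)\<close>, which is exactly half the size of
      \<open>A\<close>.\<close>
    define y where "y = m * card A"
    have "{p \<in> A. p \<le> y} \<subseteq> {p. prime p \<and> p \<le> y}" using A(2) by auto
    moreover have "finite {p::nat. prime p \<and> p \<le> y}"
      by (rule finite_subset[of _ "{..y}"]) auto
    ultimately have "card {p \<in> A. p \<le> y} \<le> card {p. prime p \<and> p \<le> y}" by (rule card_mono[rotated])
    also have "real \<dots> \<le> 2 * real y / real (4 * m) + K"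
      unfolding K_def by (rule card_primes_le) (use m in auto)
    also have "2 * real y / real (4 * m) = ?k / 2" using m by (simp add: y_def field_simps)
    finally have small: "real (card {p \<in> A. p \<le> y}) \<le> ?k / 2 + K" by simp
    have "card A = card {p \<in> A. p \<le> y} + card {p \<in> A. y < p}"
      using A(1) by (subst card_Un_disjoint[symmetric]) (auto intro!: arg_cong[of _ _ card])
    hence "real (card {p \<in> A. y < p}) \<ge> ?k / 2 - K" using small by linarith
    hence "real y * (?k / 2 - K) \<le> real y * real (card {p \<in> A. y < p})" by (intro mult_left_mono) auto
    also have "\<dots> = (\<Sum>p\<in>{p \<in> A. y < p}. real y)" by simp
    also have "\<dots> \<le> (\<Sum>p\<in>{p \<in> A. y < p}. real p)" by (intro sum_mono) auto
    also have "\<dots> \<le> ?S" using A(1) by (intro sum_mono2) auto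
    finally have "real m * (?k * (?k / 2 - K)) \<le> ?S" by (simp add: y_def mult.assoc)
    hence "4 * (?k * (?k / 2 - K)) \<le> 4 / real m * ?S" using m by (simp add: field_simps)
    also have "\<dots> \<le> \<epsilon> * ?S" using m by (intro mult_right_mono) (auto intro: sum_nonneg)
    finally have "4 * (?k * (?k / 2 - K)) \<le> \<epsilon> * ?S" .
    \<comment> \<open>Completing the square absorbs the linear term \<open>4 * k * K\<close> into
      \<open>k^2 + 4 * K^2\<close>.\<close>
    moreover have "0 \<le> (?k - 2 * K)\<^sup>2" by simp
    ultimately show "?k\<^sup>2 \<le> \<epsilon> * ?S + 4 * K\<^sup>2" by (simp add: power2_eq_square algebra_simps)
  qed
qed

section \<open>Roots of polynomials modulo primes\<close>

lemma eq_if_dvd_int_diff: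
  assumes "a < n" "b < n" "int n dvd int a - int b"
  shows "a = b"
proof (rule ccontr)
  assume "a \<noteq> b"
  hence "int n \<le> \<bar>int a - int b\<bar>" using assms(3) dvd_imp_le_int[of "int a - int b" "int n"] by simp
  thus False using assms by linarith
qed

text \<open>Lagrange's theorem modulo \<open>p\<close>. Synthetic division by a root
  \<open>a\<close> leaves the remainder \<open>P(a)\<close>, which is only zero modulo
  \<open>p\<close>, so any other root must be a root of the quotient. The quotient keeps the leading
  coefficient, so the hypothesis survives the induction.\<close>

lemma card_roots_mod_prime_le_degree:
  fixes P :: "int poly"
  assumes "prime p" "\<not> int p dvd lead_coeff P"
  shows "card {a\<in>{..<p}. int p dvd poly P (int a)} \<le> degree P"
  using assms(2)
proof (induction "degree P" arbitrary: P)
  case 0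
  then obtain c where "P = [:c:]" using degree_eq_zeroE by metis
  with 0 show ?case by simp
next
  case (Suc n)
  let ?R = "\<lambda>P. {a\<in>{..<p}. int p dvd poly P (int a)}"
  have prime: "prime (int p)" using assms(1) by simp
  show ?case
  proof (cases "?R P = {}")
    case False
    then obtain a where a: "a < p" "int p dvd poly P (int a)" by auto
    define S where "S = synthetic_div P (int a)"
    have eq: "P + smult (int a) S = pCons (poly P (int a)) S"
      unfolding S_def by (rule synthetic_div_correct)
    have deg: "degree S = n" using Suc(2) unfolding S_def by (simp add: degree_synthetic_div)
    have "coeff P (Suc n) = coeff S n"
      using arg_cong[OF eq, of "\<lambda>q. coeff q (Suc n)"] deg by (simp add: coeff_eq_0)
    hence lc: "\<not> int p dvd lead_coeff S" using Suc deg by simp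
    have val: "poly P x = (x - int a) * poly S x + poly P (int a)" for x
      using arg_cong[OF eq, of "\<lambda>q. poly q x"] by (simp add: algebra_simps)
    have "?R P \<subseteq> insert a (?R S)"
    proof
      fix b assume b: "b \<in> ?R P"
      hence "int p dvd (int b - int a) * poly S (int b)"
        using val[of "int b"] a(2) by (metis (no_types, lifting) dvd_add_left_iff mem_Collect_eq)
      hence "int p dvd int b - int a \<or> int p dvd poly S (int b)"
        using prime by (simp add: prime_dvd_mult_iff)
      moreover have "b = a" if "int p dvd int b - int a"
        using eq_if_dvd_int_diff[OF _ a(1) that] b by simp
      ultimately show "b \<in> insert a (?R S)" using b by auto
    qed
    hence "card (?R P) \<le> card (insert a (?R S))" by (intro card_mono) auto
    also have "\<dots> \<le> Suc (card (?R S))" by (rule card_insert_le_m1) auto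
    also have "\<dots> \<le> Suc n" using Suc(1)[of S] deg lc by simp
    finally show ?thesis using Suc(2) by simp
  qed (simp only: card.empty)
qed

text \<open>Lagrange's bound can fail when \<open>p\<close> divides the leading coefficient, but
  such a prime is at most the absolute value of that coefficient, and there are at most
  \<open>p\<close> residues anyway.\<close>

lemma card_roots_mod_prime_bounded:
  fixes P :: "int poly"
  assumes "P \<noteq> 0"
  obtains D where "\<And>p. prime p \<Longrightarrow> card {a\<in>{..<p}. int p dvd poly P (int a)} \<le> D"
proof (rule that[of "degree P + nat \<bar>lead_coeff P\<bar>"])
  fix p :: nat assume p: "prime p"
  show "card {a\<in>{..<p}. int p dvd poly P (int a)} \<le> degree P + nat \<bar>lead_coeff P\<bar>"
  proof (cases "int p dvd lead_coeff P")
    case True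
    hence "int p \<le> \<bar>lead_coeff P\<bar>" using assms dvd_imp_le_int[of "lead_coeff P" "int p"] by simp
    moreover have "card {a\<in>{..<p}. int p dvd poly P (int a)} \<le> card {..<p}" by (rule card_mono) auto
    ultimately show ?thesis by simp
  qed (use card_roots_mod_prime_le_degree[OF p, of P] in simp)
qed

section \<open>Counting fractions in short intervals\<close>

text \<open>The fractional part encodes membership in \<open>(0, \<delta>)\<close> modulo 1 without
  a quantifier over integer shifts. The strict lower bound excludes a difference of 0.\<close>

definition in_window :: "real \<Rightarrow> real \<Rightarrow> bool" where
  "in_window \<delta> x \<longleftrightarrow> 0 < frac x \<and> frac x < \<delta>"

text \<open>The window fits into one period, so the shift can only be the floor of \<open>x\<close>.
  For \<open>\<delta> > 1\<close> an integer \<open>x\<close> would satisfy the right side although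
  its fractional part is 0.\<close>

lemma in_window_iff:
  assumes "\<delta> \<le> 1"
  shows "in_window \<delta> x \<longleftrightarrow> (\<exists>k::int. 0 < x - of_int k \<and> x - of_int k < \<delta>)"
proof
  assume "\<exists>k::int. 0 < x - of_int k \<and> x - of_int k < \<delta>"
  then obtain k :: int where k: "0 < x - of_int k" "x - of_int k < \<delta>" by blast
  hence "frac x = x - of_int k" using assms by (subst frac_unique_iff) auto
  thus "in_window \<delta> x" using k by (simp add: in_window_def)
qed (auto simp: in_window_def frac_def)

lemma card_int_greaterThanLessThan_real:
  "card {c::int. x < of_int c \<and> of_int c < (y::real)} = nat (\<lceil>y\<rceil> - 1 - \<lfloor>x\<rfloor>)"
proof -
  have "{c::int. x < of_int c \<and> of_int c < y} = {\<lfloor>x\<rfloor> + 1..\<lceil>y\<rceil> - 1}"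
    by (auto simp: floor_less_iff[symmetric] less_ceiling_iff[symmetric])
  thus ?thesis by simp
qed

text \<open>The \<open>n\<close> values of \<open>f\<close> are pairwise incongruent modulo
  \<open>n\<close>, so they represent each residue exactly once. After reduction to
  \<open>0, ..., n - 1\<close> the fractional part is explicit, and the count becomes that of the
  integers in an open interval of length \<open>n * \<delta>\<close>.\<close>

lemma card_in_window_residues:
  fixes f :: "'a \<Rightarrow> int" and s \<delta> :: real
  assumes "finite J" "card J = n" "n > 0"
    and inj: "\<And>i j. i \<in> J \<Longrightarrow> j \<in> J \<Longrightarrow> int n dvd f i - f j \<Longrightarrow> i = j"
    and s: "0 \<le> s" "s < 1" and \<delta>: "0 < \<delta>" "\<delta> \<le> 1"
  shows "card {j\<in>J. in_window \<delta> ((of_int (f j) + s) / real n)} = nat (\<lceil>real n * \<delta> - s\<rceil> - 1 - \<lfloor>- s\<rfloor>)"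
proof -
  define h where "h j = f j mod int n" for j
  have inj_h: "inj_on h J" using inj by (auto simp: inj_on_def h_def mod_eq_dvd_iff)
  have "h ` J \<subseteq> {0..<int n}" using \<open>n > 0\<close> by (auto simp: h_def)
  moreover have "card (h ` J) = card {0..<int n}" using inj_h assms by (simp add: card_image)
  ultimately have img: "h ` J = {0..<int n}" by (intro card_subset_eq) auto
  have frac: "frac ((of_int (f j) + s) / real n) = (of_int (h j) + s) / real n" for j
  proof -
    have "real_of_int (f j) = of_int (int n * (f j div int n) + h j)" by (simp add: h_def)
    hence "(of_int (f j) + s) / real n - (of_int (h j) + s) / real n = of_int (f j div int n)"
      using \<open>n > 0\<close> by (simp add: field_simps)
    moreover have "0 \<le> h j" "h j + 1 \<le> int n" using \<open>n > 0\<close> by (auto simp: h_def zless_imp_add1_zle)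
    hence "0 \<le> real_of_int (h j)" "real_of_int (h j) + 1 \<le> real n" by linarith+
    ultimately show ?thesis using s \<open>n > 0\<close> by (subst frac_unique_iff) (auto simp: Ints_def)
  qed
  have "card {j\<in>J. in_window \<delta> ((of_int (f j) + s) / real n)}
      = card {j\<in>J. - s < of_int (h j) \<and> of_int (h j) < real n * \<delta> - s}"
    unfolding in_window_def frac using \<open>n > 0\<close>
    by (intro arg_cong[of _ _ card]) (auto simp: field_simps)
  also have "card {j\<in>J. - s < of_int (h j) \<and> of_int (h j) < real n * \<delta> - s}
      = card (h ` {j\<in>J. - s < of_int (h j) \<and> of_int (h j) < real n * \<delta> - s})"
    using inj_h by (intro card_image[symmetric] inj_on_subset[OF inj_h]) auto
  also have "h ` {j\<in>J. - s < of_int (h j) \<and> of_int (h j) < real n * \<delta> - s}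
      = {c\<in>h ` J. - s < of_int c \<and> of_int c < real n * \<delta> - s}" by auto
  also have "\<dots> = {c::int. - s < of_int c \<and> of_int c < real n * \<delta> - s}"
  proof -
    have "c \<in> {0..<int n}" if "- s < of_int c" "of_int c < real n * \<delta> - s" for c :: int
    proof -
      \<comment> \<open>Since \<open>\<delta> \<le> 1\<close> and \<open>s < 1\<close>, every
        integer of the interval is a reduced residue between 0 and \<open>n - 1\<close>, so none is
        missed.\<close>
      have "real n * \<delta> \<le> real n" using \<delta> by (simp add: mult_left_le)
      hence "of_int c < real n" "- 1 < real_of_int c" using that s by linarith+
      thus ?thesis by simp
    qed
    thus ?thesis unfolding img by blast
  qed
  finally show ?thesis by (simp add: card_int_greaterThanLessThan_real)
qed

text \<open>An arbitrary offset \<open>\<theta>\<close> reduces to the exact count: the integer part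
  of \<open>\<theta> * n\<close> only translates the residues, and its fractional part becomes the
  shift \<open>s\<close>.\<close>

lemma card_in_window_residues_approx:
  fixes f :: "'a \<Rightarrow> int" and \<theta> \<delta> :: real
  assumes "finite J" "card J = n" "n > 0"
    and inj: "\<And>i j. i \<in> J \<Longrightarrow> j \<in> J \<Longrightarrow> int n dvd f i - f j \<Longrightarrow> i = j"
    and \<delta>: "0 < \<delta>" "\<delta> \<le> 1"
  shows "\<bar>(\<Sum>j\<in>J. of_bool (in_window \<delta> (\<theta> + of_int (f j) / real n))) - real n * \<delta>\<bar> \<le> 1"
proof -
  define s where "s = frac (\<theta> * real n)"
  define g where "g j = f j + \<lfloor>\<theta> * real n\<rfloor>" for j
  have s: "0 \<le> s" "s < 1" unfolding s_def by (auto simp: frac_lt_1)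
  have eq: "\<theta> + of_int (f j) / real n = (of_int (g j) + s) / real n" for j
    using \<open>n > 0\<close> by (simp add: s_def g_def frac_def field_simps)
  have "(\<Sum>j\<in>J. of_bool (in_window \<delta> (\<theta> + of_int (f j) / real n)))
      = real (card {j\<in>J. in_window \<delta> ((of_int (g j) + s) / real n)})"
    using \<open>finite J\<close> by (simp add: eq of_bool_def sum.If_cases Int_def)
  also have "\<dots> = real (nat (\<lceil>real n * \<delta> - s\<rceil> - 1 - \<lfloor>- s\<rfloor>))"
    by (subst card_in_window_residues[OF assms(1-3) _ s \<delta>]) (auto simp: g_def intro: inj)
  finally have *: "(\<Sum>j\<in>J. of_bool (in_window \<delta> (\<theta> + of_int (f j) / real n))) = \<dots>" .
  \<comment> \<open>Positive length keeps the argument of \<open>nat\<close> non-negative, so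
    nothing is truncated.\<close>
  have "real n * \<delta> > 0" using assms by simp
  thus ?thesis unfolding * by linarith
qed


text \<open>The admissible numerators over a prime \<open>p\<close>, as residues from 0 to
  \<open>p - 1\<close> instead of 1 to \<open>p\<close>. When \<open>P(0) = 0\<close>, both 0 and
  \<open>p\<close> are roots modulo \<open>p\<close>, so the two ranges give the same
  numerators.\<close>

definition nonroots :: "int poly \<Rightarrow> nat \<Rightarrow> nat set" where
  "nonroots P p = {a\<in>{..<p}. \<not> int p dvd poly P (int a)}"

text \<open>The share of the ordered pair of denominators \<open>p\<close>, \<open>q\<close> in the
  unnormalised pair correlation.\<close>

definition window_count :: "int poly \<Rightarrow> real \<Rightarrow> nat \<Rightarrow> nat \<Rightarrow> real" where
  "window_count P \<delta> p q = (\<Sum>a\<in>nonroots P p. \<Sum>b\<in>nonroots P q.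
     of_bool (in_window \<delta> (real a / real p - real b / real q)))"

lemma finite_nonroots [simp]: "finite (nonroots P p)"
  by (simp add: nonroots_def)

lemma card_nonroots: "card (nonroots P p) + card {a\<in>{..<p}. int p dvd poly P (int a)} = p"
proof -
  have "card (nonroots P p \<union> {a\<in>{..<p}. int p dvd poly P (int a)}) = card {..<p}"
    by (rule arg_cong[of _ _ card]) (auto simp: nonroots_def)
  thus ?thesis by (subst card_Un_disjoint[symmetric]) (auto simp: nonroots_def)
qed

text \<open>Inclusion-exclusion removes the roots from the full box of residues. The four main terms
  recombine to \<open>\<delta> * (p - r) * (q - s)\<close>, where \<open>r\<close> and
  \<open>s\<close> count the roots, and the four errors are at most 1, \<open>r\<close>,
  \<open>s\<close> and \<open>r * s\<close>.\<close>

lemma window_count_distinct_primes: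
  assumes pq: "prime p" "prime q" "p \<noteq> q" and \<delta>: "0 < \<delta>" "\<delta> \<le> 1"
    and D: "card {a\<in>{..<p}. int p dvd poly P (int a)} \<le> D"
           "card {a\<in>{..<q}. int q dvd poly P (int a)} \<le> D"
  shows "\<bar>window_count P \<delta> p q - \<delta> * real (card (nonroots P p)) * real (card (nonroots P q))\<bar>
    \<le> (1 + real D)\<^sup>2"
proof -
  define R where "R p = {a\<in>{..<p}. int p dvd poly P (int a)}" for p :: nat
  define \<phi> where "\<phi> a b = (of_bool (in_window \<delta> (real a / real p - real b / real q)) :: real)" for a b :: nat
  let ?r = "real (card (R p))" and ?s = "real (card (R q))"
  have pos: "p > 0" "q > 0" using pq by (auto simp: prime_gt_0_nat)
  have fR: "finite (R n)" "R n \<subseteq> {..<n}" "nonroots P n = {..<n} - R n" for n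
    by (auto simp: R_def nonroots_def)
  have g: "real (card (nonroots P n)) = real n - real (card (R n))" for n
    using card_nonroots[of P n] unfolding R_def by linarith
  have split: "sum h (nonroots P n) = sum h {..<n} - sum h (R n)" for h :: "nat \<Rightarrow> real" and n
    unfolding fR(3) using fR by (simp add: sum_diff)
  define X where "X = (\<Sum>a\<in>R p. \<Sum>b<q. \<phi> a b)"
  define Y where "Y = (\<Sum>b\<in>R q. \<Sum>a<p. \<phi> a b)"
  define Z where "Z = (\<Sum>a\<in>R p. \<Sum>b\<in>R q. \<phi> a b)"
  define W where "W = (\<Sum>a<p. \<Sum>b<q. \<phi> a b)"
  have "window_count P \<delta> p q = (\<Sum>a\<in>nonroots P p. \<Sum>b\<in>nonroots P q. \<phi> a b)"
    by (simp add: window_count_def \<phi>_def)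
  also have "\<dots> = W - (\<Sum>a<p. \<Sum>b\<in>R q. \<phi> a b) - (X - Z)"
    by (simp add: split sum_subtractf W_def X_def Z_def)
  also have "(\<Sum>a<p. \<Sum>b\<in>R q. \<phi> a b) = Y" unfolding Y_def by (rule sum.swap)
  finally have count: "window_count P \<delta> p q = W - Y - (X - Z)" .

  \<comment> \<open>With \<open>a\<close> fixed, \<open>-b\<close> runs once through the residues
    modulo \<open>q\<close>, offset by \<open>a / p\<close>.\<close>
  have "\<bar>(\<Sum>b<q. \<phi> a b) - real q * \<delta>\<bar> \<le> 1" for a
  proof -
    have "\<bar>(\<Sum>b<q. of_bool (in_window \<delta> (real a / real p + of_int (- int b) / real q))) - real q * \<delta>\<bar> \<le> 1"
    proof (rule card_in_window_residues_approx)
      fix i j assume "i \<in> {..<q}" "j \<in> {..<q}" "int q dvd - int i - - int j"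
      thus "i = j" using eq_if_dvd_int_diff[of j q i] by auto
    qed (use pos \<delta> in auto)
    thus ?thesis by (simp add: \<phi>_def)
  qed
  hence "(\<Sum>a\<in>R p. \<bar>(\<Sum>b<q. \<phi> a b) - real q * \<delta>\<bar>) \<le> (\<Sum>a\<in>R p. 1)" by (intro sum_mono)
  moreover have "X - ?r * real q * \<delta> = (\<Sum>a\<in>R p. (\<Sum>b<q. \<phi> a b) - real q * \<delta>)"
    by (simp add: X_def sum_subtractf)
  ultimately have X: "\<bar>X - ?r * real q * \<delta>\<bar> \<le> ?r"
    using sum_abs[of "\<lambda>a. (\<Sum>b<q. \<phi> a b) - real q * \<delta>" "R p"] by (simp del: sum_abs)

  have "\<bar>(\<Sum>a<p. \<phi> a b) - real p * \<delta>\<bar> \<le> 1" for b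
  proof -
    have "\<bar>(\<Sum>a<p. of_bool (in_window \<delta> (- real b / real q + of_int (int a) / real p))) - real p * \<delta>\<bar> \<le> 1"
    proof (rule card_in_window_residues_approx)
      fix i j assume "i \<in> {..<p}" "j \<in> {..<p}" "int p dvd int i - int j"
      thus "i = j" using eq_if_dvd_int_diff[of i p j] by auto
    qed (use pos \<delta> in auto)
    thus ?thesis by (simp add: \<phi>_def)
  qed
  hence "(\<Sum>b\<in>R q. \<bar>(\<Sum>a<p. \<phi> a b) - real p * \<delta>\<bar>) \<le> (\<Sum>b\<in>R q. 1)" by (intro sum_mono)
  moreover have "Y - ?s * real p * \<delta> = (\<Sum>b\<in>R q. (\<Sum>a<p. \<phi> a b) - real p * \<delta>)"
    by (simp add: Y_def sum_subtractf)
  ultimately have Y: "\<bar>Y - ?s * real p * \<delta>\<bar> \<le> ?s"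
    using sum_abs[of "\<lambda>b. (\<Sum>a<p. \<phi> a b) - real p * \<delta>" "R q"] by (simp del: sum_abs)

  \<comment> \<open>Both \<open>Z\<close> and its main term lie between 0 and \<open>r * s\<close>,
    so no equidistribution is required here.\<close>
  have "Z \<le> (\<Sum>a\<in>R p. \<Sum>b\<in>R q. 1)" unfolding Z_def \<phi>_def by (intro sum_mono) auto
  moreover have "Z \<ge> 0" unfolding Z_def \<phi>_def by (intro sum_nonneg) auto
  moreover have "?r * ?s * \<delta> \<le> ?r * ?s" "?r * ?s * \<delta> \<ge> 0" using \<delta> by (auto intro: mult_left_le)
  ultimately have Z: "\<bar>Z - ?r * ?s * \<delta>\<bar> \<le> ?r * ?s" by (simp add: abs_le_iff)

  have "\<bar>(\<Sum>ab\<in>{..<p} \<times> {..<q}. of_bool (in_window \<delta> (0 +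
      of_int (int (fst ab) * int q - int (snd ab) * int p) / real (p * q)))) - real (p * q) * \<delta>\<bar> \<le> 1"
  proof (rule card_in_window_residues_approx)
    fix i j assume ij: "i \<in> {..<p} \<times> {..<q}" "j \<in> {..<p} \<times> {..<q}"
      and dvd: "int (p * q) dvd int (fst i) * int q - int (snd i) * int p
                 - (int (fst j) * int q - int (snd j) * int p)"
    obtain a b c d where eq: "i = (a, b)" "j = (c, d)" by (cases i, cases j)
    \<comment> \<open>Chinese remaindering: modulo \<open>p\<close> only the difference of the first
      coordinates survives, modulo \<open>q\<close> only that of the second.\<close>
    have dvd': "int p * int q dvd (int a - int c) * int q - (int b - int d) * int p"
      using dvd by (simp add: eq algebra_simps)
    have cop: "coprime (int p) (int q)" using pq by (simp add: primes_coprime)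
    have "int p dvd (int a - int c) * int q" using dvd_mult_left[OF dvd'] by (simp add: dvd_diff_left_iff)
    hence "int p dvd int a - int c" using cop by (simp add: coprime_dvd_mult_left_iff)
    moreover have "int q dvd (int b - int d) * int p"
      using dvd_mult_right[OF dvd'] by (simp add: dvd_diff_right_iff)
    hence "int q dvd int b - int d" using cop by (simp add: coprime_dvd_mult_left_iff coprime_commute)
    ultimately show "i = j" using ij eq eq_if_dvd_int_diff by (metis lessThan_iff mem_Sigma_iff)
  qed (use pos \<delta> in auto)
  moreover have "(of_int (int a * int q - int b * int p) / real (p * q) :: real)
      = real a / real p - real b / real q" for a b using pos by (simp add: field_simps)
  ultimately have W: "\<bar>W - real p * real q * \<delta>\<bar> \<le> 1"
    by (simp add: W_def \<phi>_def sum.cartesian_product case_prod_beta del: sum_of_bool_eq)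

  have "window_count P \<delta> p q - \<delta> * real (card (nonroots P p)) * real (card (nonroots P q))
      = (W - real p * real q * \<delta>) - (Y - ?s * real p * \<delta>)
        - (X - ?r * real q * \<delta>) + (Z - ?r * ?s * \<delta>)"
    unfolding count g by (simp add: algebra_simps)
  hence "\<bar>window_count P \<delta> p q - \<delta> * real (card (nonroots P p)) * real (card (nonroots P q))\<bar>
      \<le> 1 + ?s + ?r + ?r * ?s" using X Y Z W by linarith
  also have "\<dots> = (1 + ?r) * (1 + ?s)" by (simp add: algebra_simps)
  also have "\<dots> \<le> (1 + real D) * (1 + real D)" using D by (intro mult_mono) (auto simp: R_def)
  finally show ?thesis by (simp add: power2_eq_square)
qed

text \<open>The differences lie on the grid of multiples of \<open>1 / p\<close>, and for each
  \<open>a\<close> at most \<open>\<lceil>p * \<delta>\<rceil> - 1\<close> grid classes fall into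
  the window. If \<open>p * \<delta> \<le> 1\<close>, the open window ends no later than the first
  nonzero grid point and is empty.\<close>

lemma window_count_same_prime:
  assumes "p > 0" "0 < \<delta>" "\<delta> \<le> 1"
  shows "0 \<le> window_count P \<delta> p p" "window_count P \<delta> p p \<le> \<delta> * (real p)\<^sup>2"
    and "real p * \<delta> \<le> 1 \<Longrightarrow> window_count P \<delta> p p = 0"
proof -
  define v where "v = real (nat (\<lceil>real p * \<delta>\<rceil> - 1))"
  show nonneg: "0 \<le> window_count P \<delta> p p" unfolding window_count_def by (intro sum_nonneg) auto
  have *: "(\<Sum>b<p. of_bool (in_window \<delta> (real a / real p - real b / real p))) = v" for a
  proof -
    have "card {b\<in>{..<p}. in_window \<delta> ((of_int (int a - int b) + 0) / real p)}
        = nat (\<lceil>real p * \<delta> - 0\<rceil> - 1 - \<lfloor>- 0::real\<rfloor>)"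
    proof (rule card_in_window_residues)
      fix i j assume "i \<in> {..<p}" "j \<in> {..<p}" "int p dvd int a - int i - (int a - int j)"
      thus "i = j" using eq_if_dvd_int_diff[of j p i] by auto
    qed (use assms in auto)
    thus ?thesis by (simp add: v_def of_bool_def sum.If_cases Int_def diff_divide_distrib)
  qed
  have "window_count P \<delta> p p \<le> (\<Sum>a<p. \<Sum>b<p. of_bool (in_window \<delta> (real a / real p - real b / real p)))"
    unfolding window_count_def nonroots_def
    by (intro order_trans[OF sum_mono sum_mono2] sum_mono2 sum_nonneg) auto
  hence le: "window_count P \<delta> p p \<le> real p * v" by (simp add: *)
  have "real p * \<delta> > 0" using assms by simp
  hence "v \<le> real p * \<delta>" unfolding v_def by linarith
  hence "real p * v \<le> real p * (real p * \<delta>)" by (intro mult_left_mono) auto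
  thus "window_count P \<delta> p p \<le> \<delta> * (real p)\<^sup>2" using le by (simp add: power2_eq_square algebra_simps)
  assume "real p * \<delta> \<le> 1"
  hence "v = 0" by (simp add: v_def ceiling_le_iff)
  thus "window_count P \<delta> p p = 0" using le nonneg by simp
qed

section \<open>Pair correlation of prime fractions\<close>

text \<open>Since \<open>P(0) = 0\<close>, the numerators 0 and \<open>p\<close> are excluded. The
  remaining fractions are in lowest terms with prime denominator, so each value determines its
  denominator and numerator, and counting fractions amounts to counting pairs.\<close>

lemma prime_fractions_eq_image:
  assumes "coeff P 0 = 0" "A \<subseteq> {p. prime p \<and> p \<le> Q}"
  shows "prime_fractions Q A P = (\<lambda>(p, a). real a / real p) ` (SIGMA p:A. nonroots P p)"
    and "inj_on (\<lambda>(p, a). real a / real p) (SIGMA p:A. nonroots P p)"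
proof -
  have dvd: "int p dvd poly P (int p)" for p :: nat
    using assms(1) by (cases P) simp
  have gcd: "gcd (poly P (int a)) (int p) = 1 \<longleftrightarrow> \<not> int p dvd poly P (int a)" if "prime p" for a p :: nat
  proof
    assume "\<not> int p dvd poly P (int a)"
    hence "coprime (int p) (poly P (int a))" using that by (intro prime_imp_coprime) auto
    thus "gcd (poly P (int a)) (int p) = 1" by (simp add: coprime_iff_gcd_eq_1 gcd.commute)
  next
    assume "gcd (poly P (int a)) (int p) = 1"
    moreover have "\<not> int p dvd 1" using that by (simp add: prime_gt_Suc_0_nat nat_neq_iff)
    ultimately show "\<not> int p dvd poly P (int a)" by (metis dvd_refl gcd_greatest)
  qed
  have pos: "a > 0" if "a \<in> nonroots P p" for a p
    using that assms(1) by (cases "a = 0") (auto simp: nonroots_def poly_0_coeff_0)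
  show "prime_fractions Q A P = (\<lambda>(p, a). real a / real p) ` (SIGMA p:A. nonroots P p)" (is "?l = ?r")
  proof
    show "?l \<subseteq> ?r"
    proof
      fix x assume "x \<in> ?l"
      then obtain a p where x: "x = real a / real p" "a \<le> p" "p \<in> A" "gcd (poly P (int a)) (int p) = 1"
        by (auto simp: prime_fractions_def)
      hence nd: "\<not> int p dvd poly P (int a)" using gcd[of p a] assms(2) by auto
      hence "a \<noteq> p" using dvd by auto
      hence mem: "(p, a) \<in> (SIGMA p:A. nonroots P p)" using x nd by (auto simp: nonroots_def)
      show "x \<in> ?r" by (rule image_eqI[OF _ mem]) (simp add: x(1))
    qed
    show "?r \<subseteq> ?l"
    proof clarify
      fix p a assume pa: "p \<in> A" "a \<in> nonroots P p"
      hence h: "1 \<le> a" "a \<le> p" "p \<le> Q" "gcd (poly P (int a)) (int p) = 1"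
        using pos[of a p] gcd[of p a] assms(2) by (auto simp: nonroots_def)
      show "real a / real p \<in> ?l" unfolding prime_fractions_def
        by (intro CollectI exI[of _ a] exI[of _ p] conjI refl pa(1) h)
    qed
  qed
  show "inj_on (\<lambda>(p, a). real a / real p) (SIGMA p:A. nonroots P p)"
  proof (rule inj_onI, clarify)
    fix p a q b assume *: "p \<in> A" "a \<in> nonroots P p" "q \<in> A" "b \<in> nonroots P q"
      "real a / real p = real b / real q"
    have prime: "prime p" "prime q" using * assms(2) by auto
    hence "p > 0" "q > 0" by (auto simp: prime_gt_0_nat)
    hence "real (a * q) = real (b * p)" using *(5) by (simp add: field_simps)
    hence eq: "a * q = b * p" by (simp only: of_nat_eq_iff)
    have ab: "0 < a" "a < p" using *(2) pos by (auto simp: nonroots_def)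
    have "p dvd a * q" using eq by simp
    moreover have "\<not> p dvd a" using ab by (simp add: nat_dvd_not_less)
    ultimately have "p dvd q" using prime by (simp add: prime_dvd_mult_iff)
    hence "p = q" using prime primes_dvd_imp_eq by blast
    thus "p = q \<and> a = b" using eq \<open>p > 0\<close> by auto
  qed
qed

lemma card_prime_fractions:
  assumes "coeff P 0 = 0" "A \<subseteq> {p. prime p \<and> p \<le> Q}"
  shows "card (prime_fractions Q A P) = (\<Sum>p\<in>A. card (nonroots P p))"
proof -
  have "finite A" by (rule finite_subset[of _ "{..Q}"]) (use assms(2) in auto)
  thus ?thesis using prime_fractions_eq_image[OF assms] by (simp add: card_image card_SigmaI)
qed

text \<open>The condition \<open>\<Lambda> \<le> N\<close> makes the window length at most 1, so
  fractional parts describe it. The requirement of distinct points is then automatic, and the sum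
  over pairs of fractions splits by denominators.\<close>

lemma pair_corr_prime_fractions:
  fixes N :: nat
  assumes "coeff P 0 = 0" "A \<subseteq> {p. prime p \<and> p \<le> Q}"
    and N: "N = card (prime_fractions Q A P)" "N > 0" and "0 < \<Lambda>" "\<Lambda> \<le> real N"
  shows "real N * pair_corr (prime_fractions Q A P) \<Lambda>
    = (\<Sum>p\<in>A. \<Sum>q\<in>A. window_count P (\<Lambda> / real N) p q)"
proof -
  define F where "F = prime_fractions Q A P"
  define \<delta> where "\<delta> = \<Lambda> / real N"
  have \<delta>: "\<delta> \<le> 1" using assms by (simp add: \<delta>_def)
  have finA: "finite A" by (rule finite_subset[of _ "{..Q}"]) (use assms(2) in auto)
  have finF: "finite F" using N by (auto simp: F_def intro: card_ge_0_finite)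
  have cond: "x \<noteq> y \<and> (\<exists>t\<in>{0<..<\<Lambda>}. \<exists>k::int. x - y = 1 / real N * t + of_int k) \<longleftrightarrow> in_window \<delta> (x - y)" for x y
  proof
    assume "x \<noteq> y \<and> (\<exists>t\<in>{0<..<\<Lambda>}. \<exists>k::int. x - y = 1 / real N * t + of_int k)"
    then obtain t k where t: "0 < t" "t < \<Lambda>" "x - y = 1 / real N * t + of_int k" by auto
    hence "0 < x - y - of_int k \<and> x - y - of_int k < \<delta>"
      using N(2) by (simp add: \<delta>_def divide_strict_right_mono)
    thus "in_window \<delta> (x - y)" using \<delta> by (subst in_window_iff) auto
  next
    assume w: "in_window \<delta> (x - y)"
    then obtain k :: int where k: "0 < x - y - of_int k" "x - y - of_int k < \<delta>"
      using in_window_iff[OF \<delta>] by blast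
    have "real N * (x - y - of_int k) \<in> {0<..<\<Lambda>}"
      using k N(2) by (simp add: \<delta>_def pos_less_divide_eq mult.commute)
    moreover have "x - y = 1 / real N * (real N * (x - y - of_int k)) + of_int k" using N(2) by simp
    moreover have "x \<noteq> y" using w by (auto simp: in_window_def)
    ultimately show "x \<noteq> y \<and> (\<exists>t\<in>{0<..<\<Lambda>}. \<exists>k::int. x - y = 1 / real N * t + of_int k)" by blast
  qed
  have "real N * pair_corr F \<Lambda> = real (card {(x, y). x \<in> F \<and> y \<in> F \<and> x \<noteq> y \<and>
      (\<exists>t\<in>{0<..<\<Lambda>}. \<exists>k::int. x - y = 1 / real N * t + of_int k)})"
    using N by (simp add: pair_corr_def F_def)
  also have "\<dots> = real (card {z \<in> F \<times> F. in_window \<delta> (fst z - snd z)})"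
    unfolding cond by (intro arg_cong[of _ _ "\<lambda>S. real (card S)"]) auto
  also have "\<dots> = (\<Sum>z\<in>F \<times> F. of_bool (in_window \<delta> (fst z - snd z)))"
    using finF by (simp add: of_bool_def sum.If_cases Int_def)
  also have "\<dots> = (\<Sum>x\<in>F. \<Sum>y\<in>F. of_bool (in_window \<delta> (x - y)))"
    by (simp add: sum.cartesian_product case_prod_beta)
  also have "\<dots> = (\<Sum>(p, a)\<in>(SIGMA p:A. nonroots P p). \<Sum>(q, b)\<in>(SIGMA q:A. nonroots P q).
      of_bool (in_window \<delta> (real a / real p - real b / real q)))"
    unfolding F_def prime_fractions_eq_image(1)[OF assms(1,2)]
    unfolding sum.reindex[OF prime_fractions_eq_image(2)[OF assms(1,2)]]
    by (simp add: case_prod_unfold)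
  also have "\<dots> = (\<Sum>p\<in>A. \<Sum>a\<in>nonroots P p. \<Sum>q\<in>A. \<Sum>b\<in>nonroots P q.
      of_bool (in_window \<delta> (real a / real p - real b / real q)))"
    using finA by (subst (1 2) sum.Sigma) (auto simp: case_prod_unfold)
  also have "\<dots> = (\<Sum>p\<in>A. \<Sum>q\<in>A. window_count P \<delta> p q)"
    unfolding window_count_def by (intro sum.cong refl sum.swap)
  finally show ?thesis by (simp add: F_def \<delta>_def)
qed

lemma pair_corr_prime_fractions_approx:
  fixes N :: nat
  assumes "coeff P 0 = 0" "A \<subseteq> {p. prime p \<and> p \<le> Q}"
    and N: "N = card (prime_fractions Q A P)" "N > 0" and \<Lambda>: "0 < \<Lambda>" "\<Lambda> \<le> real N"
    and D: "\<And>p. prime p \<Longrightarrow> card {a\<in>{..<p}. int p dvd poly P (int a)} \<le> D"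
  shows "\<bar>pair_corr (prime_fractions Q A P) \<Lambda> - \<Lambda>
       + \<Lambda> * (\<Sum>p\<in>A. (real (card (nonroots P p)))\<^sup>2) / (real N)\<^sup>2
       - (\<Sum>p\<in>A. window_count P (\<Lambda> / real N) p p) / real N\<bar>
    \<le> (1 + real D)\<^sup>2 * (real (card A))\<^sup>2 / real N"
proof -
  define \<delta> where "\<delta> = \<Lambda> / real N"
  define E where "E = (1 + real D)\<^sup>2"
  define g where "g p = real (card (nonroots P p))" for p
  define w where "w = window_count P \<delta>"
  define pc where "pc = pair_corr (prime_fractions Q A P) \<Lambda>"
  have \<delta>: "0 < \<delta>" "\<delta> \<le> 1" using N \<Lambda> by (auto simp: \<delta>_def)
  have finA: "finite A" by (rule finite_subset[of _ "{..Q}"]) (use assms(2) in auto)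
  have prime: "prime p" if "p \<in> A" for p using that assms(2) by auto
  have sum_g: "(\<Sum>p\<in>A. g p) = real N"
    using card_prime_fractions[OF assms(1,2)] N by (simp add: g_def)
  \<comment> \<open>The correction makes the error vanish on the diagonal. The main term can
    therefore be summed over all pairs, giving \<open>\<delta> * N^2\<close>, while the diagonal is
    kept exactly.\<close>
  have err: "\<bar>w p q - \<delta> * g p * g q - (if p = q then w p p - \<delta> * (g p)\<^sup>2 else 0)\<bar> \<le> E"
    if "p \<in> A" "q \<in> A" for p q
  proof (cases "p = q")
    case False
    thus ?thesis using window_count_distinct_primes[OF prime prime False \<delta> D D] that prime
      by (simp add: w_def g_def E_def)
  qed (simp add: power2_eq_square E_def)
  have "(\<Sum>p\<in>A. \<Sum>q\<in>A. w p q - \<delta> * g p * g q - (if p = q then w p p - \<delta> * (g p)\<^sup>2 else 0))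
      = (\<Sum>p\<in>A. \<Sum>q\<in>A. w p q) - \<delta> * (\<Sum>p\<in>A. \<Sum>q\<in>A. g p * g q)
        - (\<Sum>p\<in>A. w p p - \<delta> * (g p)\<^sup>2)"
    using finA by (simp add: sum_subtractf sum_distrib_left mult.assoc)
  also have "(\<Sum>p\<in>A. \<Sum>q\<in>A. g p * g q) = (real N)\<^sup>2"
    by (simp add: sum_product[symmetric] sum_g power2_eq_square)
  also have "(\<Sum>p\<in>A. w p p - \<delta> * (g p)\<^sup>2) = (\<Sum>p\<in>A. w p p) - \<delta> * (\<Sum>p\<in>A. (g p)\<^sup>2)"
    by (simp add: sum_subtractf sum_distrib_left)
  also have "(\<Sum>p\<in>A. \<Sum>q\<in>A. w p q) = real N * pc"
    unfolding w_def \<delta>_def pc_def using pair_corr_prime_fractions[OF assms(1-6)] by simp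
  finally have eq: "(\<Sum>p\<in>A. \<Sum>q\<in>A. w p q - \<delta> * g p * g q - (if p = q then w p p - \<delta> * (g p)\<^sup>2 else 0))
      = real N * pc - \<delta> * (real N)\<^sup>2 - ((\<Sum>p\<in>A. w p p) - \<delta> * (\<Sum>p\<in>A. (g p)\<^sup>2))" (is "?S = _") .
  have "\<bar>?S\<bar> \<le> (\<Sum>p\<in>A. \<Sum>q\<in>A. E)"
    by (intro order_trans[OF sum_abs] sum_mono err)
  also have "\<dots> = E * (real (card A))\<^sup>2" by (simp add: power2_eq_square)
  finally have "\<bar>?S / real N\<bar> \<le> E * (real (card A))\<^sup>2 / real N"
    unfolding abs_divide abs_of_nat by (intro divide_right_mono) auto
  moreover have "?S / real N = pc - \<Lambda> + \<Lambda> * (\<Sum>p\<in>A. (g p)\<^sup>2) / (real N)\<^sup>2 - (\<Sum>p\<in>A. w p p) / real N"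
    using N(2) unfolding eq by (simp add: \<delta>_def power2_eq_square diff_divide_distrib)
  ultimately show ?thesis
    unfolding pc_def E_def g_def w_def \<delta>_def by (simp only:)
qed


text \<open>Sparsity bounds the squared number of denominators by a small multiple of their sum.
  That sum exceeds the number of fractions by at most \<open>D\<close> per denominator, a loss
  absorbed into the left side.\<close>

lemma card_squared_le_card_prime_fractions:
  fixes P :: "int poly"
  assumes "coeff P 0 = 0"
    and D: "\<And>p. prime p \<Longrightarrow> card {a\<in>{..<p}. int p dvd poly P (int a)} \<le> D" and "e > 0"
  obtains K :: real where "\<And>Q A. A \<subseteq> {p. prime p \<and> p \<le> Q} \<Longrightarrow>
    (real (card A))\<^sup>2 \<le> e * real (card (prime_fractions Q A P)) + K"
proof -
  \<comment> \<open>The second entry gives \<open>\<epsilon> * D \<le> 1 / 2\<close>, so half of the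
    square moves to the left; doubling then turns \<open>e / 2\<close> into \<open>e\<close> and
    \<open>K\<close> into \<open>2 * K\<close>.\<close>
  define \<epsilon> where "\<epsilon> = min (e / 2) (1 / (2 * (real D + 1)))"
  have \<epsilon>: "\<epsilon> > 0" "\<epsilon> \<le> e / 2" using assms by (auto simp: \<epsilon>_def)
  have "\<epsilon> * real D \<le> 1 / (2 * (real D + 1)) * real D" by (intro mult_right_mono) (auto simp: \<epsilon>_def)
  also have "\<dots> \<le> 1 / 2" by (simp add: field_simps)
  finally have \<epsilon>D: "\<epsilon> * real D \<le> 1 / 2" .
  obtain K where K: "\<And>A. finite A \<Longrightarrow> (\<And>p. p \<in> A \<Longrightarrow> prime p) \<Longrightarrow>
       (real (card A))\<^sup>2 \<le> \<epsilon> * (\<Sum>p\<in>A. real p) + K"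
    using card_prime_set_squared_le[OF \<epsilon>(1)] by blast
  show ?thesis
  proof (rule that[of "2 * K"])
    fix Q :: nat and A assume A: "A \<subseteq> {p. prime p \<and> p \<le> Q}"
    let ?N = "card (prime_fractions Q A P)" and ?k = "card A"
    have fin: "finite A" by (rule finite_subset[of _ "{..Q}"]) (use A in auto)
    have "(\<Sum>p\<in>A. real p) \<le> (\<Sum>p\<in>A. real (card (nonroots P p)) + real D)"
    proof (rule sum_mono)
      fix p assume "p \<in> A"
      hence "p \<le> card (nonroots P p) + D" using card_nonroots[of P p] D[of p] A by auto
      thus "real p \<le> real (card (nonroots P p)) + real D" by linarith
    qed
    also have "\<dots> = real ?N + real D * real ?k"
      using card_prime_fractions[OF assms(1) A] by (simp add: sum.distrib)
    also have "real ?k \<le> (real ?k)\<^sup>2" by (cases ?k) (auto simp: power2_eq_square)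
    finally have "(\<Sum>p\<in>A. real p) \<le> real ?N + real D * (real ?k)\<^sup>2" by (simp add: mult_left_mono)
    hence "\<epsilon> * (\<Sum>p\<in>A. real p) \<le> \<epsilon> * (real ?N + real D * (real ?k)\<^sup>2)"
      using \<epsilon> by (intro mult_left_mono) auto
    moreover have "(\<epsilon> * real D) * (real ?k)\<^sup>2 \<le> 1 / 2 * (real ?k)\<^sup>2" using \<epsilon>D by (intro mult_right_mono) auto
    moreover have "\<epsilon> * real ?N \<le> e / 2 * real ?N" using \<epsilon> by (intro mult_right_mono) auto
    moreover have "(real ?k)\<^sup>2 \<le> \<epsilon> * (\<Sum>p\<in>A. real p) + K" using K[OF fin] A by auto
    ultimately show "(real ?k)\<^sup>2 \<le> e * real ?N + 2 * K" by (simp add: algebra_simps)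
  qed
qed

section \<open>Poissonian pair correlation forces unbounded cardinality\<close>

lemma pair_corr_zero_or_ge: "pair_corr F \<Lambda> = 0 \<or> pair_corr F \<Lambda> \<ge> 1 / real (card F)"
proof -
  obtain c :: nat where c: "pair_corr F \<Lambda> = 1 / real (card F) * real c"
    unfolding pair_corr_def by blast
  show ?thesis by (cases "c = 0") (auto simp: c divide_right_mono)
qed

text \<open>The pair correlation is a multiple of the reciprocal cardinality. Convergence to the
  small positive number \<open>1 / (2 * M)\<close> eventually gives positive values below
  \<open>1 / M\<close>, which requires more than \<open>M\<close> points.\<close>

lemma poissonian_pair_corr_imp_card_at_top:
  assumes "poissonian_pair_corr F"
  shows "filterlim (\<lambda>Q. real (card (F Q))) at_top sequentially"
  unfolding filterlim_at_top
proof
  fix Z :: real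
  define M where "M = nat \<lceil>Z\<rceil> + 1"
  have M: "M > 0" "Z \<le> real M" unfolding M_def by (simp, linarith)
  have "(\<lambda>Q. pair_corr (F Q) (1 / (2 * real M))) \<longlonglongrightarrow> 1 / (2 * real M)"
    using assms M by (simp add: poissonian_pair_corr_def)
  hence "\<forall>\<^sub>F Q in sequentially. dist (pair_corr (F Q) (1 / (2 * real M))) (1 / (2 * real M)) < 1 / (2 * real M)"
    by (rule tendstoD) (use M in simp)
  thus "\<forall>\<^sub>F Q in sequentially. Z \<le> real (card (F Q))"
  proof eventually_elim
    case (elim Q)
    define x where "x = pair_corr (F Q) (1 / (2 * real M))"
    have near: "0 < x" "x < 2 * (1 / (2 * real M))"
      using elim unfolding x_def dist_real_def by linarith+
    hence "1 / real (card (F Q)) < 1 / real M"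
      using pair_corr_zero_or_ge[of "F Q" "1 / (2 * real M)"] M unfolding x_def[symmetric] by simp
    \<comment> \<open>Cardinality 0 would make the pair correlation 0 through division by zero,
      against \<open>0 < x\<close>.\<close>
    moreover have "card (F Q) \<noteq> 0" using near(1) by (cases "card (F Q) = 0") (simp_all add: x_def pair_corr_def)
    ultimately show ?case using M by (simp add: field_simps)
  qed
qed

section \<open>The criterion for Poissonian pair correlation\<close>

lemma real_tendsto_zero_comparison:
  fixes f g :: "'a \<Rightarrow> real"
  assumes "\<forall>\<^sub>F x in F. norm (f x) \<le> g x" "(g \<longlongrightarrow> 0) F"
  shows "(f \<longlongrightarrow> 0) F"
  by (rule tendsto_0_le[OF assms(2), of _ 1], rule eventually_mono[OF assms(1)])
    (simp add: order_trans[OF _ abs_ge_self])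

text \<open>Eventual non-emptiness excludes a degenerate case: where \<open>B Q\<close> is empty,
  the little-o bound reads \<open>0 \<le> 0\<close>, whereas the pair correlation takes the default
  value 0.\<close>

theorem theorem1p5:
  fixes P :: "int poly" and B :: "nat \<Rightarrow> nat set"
  assumes "P \<noteq> 0"
    and "coeff P 0 = 0"
    and "\<And>Q. B Q \<subseteq> {p. prime p \<and> p \<le> Q}"
    and "\<forall>\<^sub>F Q in sequentially. B Q \<noteq> {}"
  shows "poissonian_pair_corr (\<lambda>Q. prime_fractions Q (B Q) P) \<longleftrightarrow>
    (\<lambda>Q. \<Sum>p\<in>B Q. (real p)\<^sup>2) \<in>
      o[sequentially](\<lambda>Q. (real (card (prime_fractions Q (B Q) P)))\<^sup>2)"
proof -
  obtain D where D: "\<And>p. prime p \<Longrightarrow> card {a\<in>{..<p}. int p dvd poly P (int a)} \<le> D"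
    using card_roots_mod_prime_bounded[OF assms(1)] by blast
  define N where "N Q = card (prime_fractions Q (B Q) P)" for Q
  define k where "k Q = real (card (B Q))" for Q
  define S where "S Q = (\<Sum>p\<in>B Q. (real p)\<^sup>2)" for Q
  define G where "G Q = (\<Sum>p\<in>B Q. (real (card (nonroots P p)))\<^sup>2)" for Q
  define E where "E = (1 + real D)\<^sup>2"
  define pc where "pc Q = pair_corr (prime_fractions Q (B Q) P)" for Q
  have finB: "finite (B Q)" for Q by (rule finite_subset[of _ "{..Q}"]) (use assms(3) in auto)
  have posB: "p > 0" if "p \<in> B Q" for p Q using that assms(3)[of Q] by (auto simp: prime_gt_0_nat)
  have approx: "\<bar>pc Q \<Lambda> - \<Lambda> + \<Lambda> * G Q / (real (N Q))\<^sup>2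
      - (\<Sum>p\<in>B Q. window_count P (\<Lambda> / real (N Q)) p p) / real (N Q)\<bar> \<le> E * (k Q)\<^sup>2 / real (N Q)"
    if "N Q > 0" "0 < \<Lambda>" "\<Lambda> \<le> real (N Q)" for Q \<Lambda>
    unfolding pc_def G_def E_def k_def
    by (rule pair_corr_prime_fractions_approx[OF assms(2,3) N_def that D])
  have GS: "0 \<le> G Q" "G Q \<le> S Q" for Q
  proof -
    show "0 \<le> G Q" unfolding G_def by (intro sum_nonneg) auto
    have "card (nonroots P p) \<le> p" for p using card_nonroots[of P p] by linarith
    thus "G Q \<le> S Q" unfolding G_def S_def by (intro sum_mono power_mono) auto
  qed
  \<comment> \<open>The converse controls only the squares of the numerator counts; \<open>p\<close>
    exceeds its count by at most \<open>D\<close>, which permits the return to squares of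
    primes.\<close>
  have SG: "S Q \<le> 2 * G Q + 2 * (real D)\<^sup>2 * k Q" for Q
  proof -
    have "S Q \<le> (\<Sum>p\<in>B Q. 2 * (real (card (nonroots P p)))\<^sup>2 + 2 * (real D)\<^sup>2)"
      unfolding S_def
    proof (rule sum_mono)
      fix p assume "p \<in> B Q"
      hence "p \<le> card (nonroots P p) + D" using card_nonroots[of P p] D[of p] assms(3)[of Q] by auto
      hence "(real p)\<^sup>2 \<le> (real (card (nonroots P p)) + real D)\<^sup>2" by (intro power_mono) auto
      also have "\<dots> \<le> 2 * (real (card (nonroots P p)))\<^sup>2 + 2 * (real D)\<^sup>2"
        using sum_squares_bound[of "real (card (nonroots P p))" "real D"] by (simp add: power2_sum)
      finally show "(real p)\<^sup>2 \<le> 2 * (real (card (nonroots P p)))\<^sup>2 + 2 * (real D)\<^sup>2" .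
    qed
    also have "\<dots> = 2 * G Q + 2 * (real D)\<^sup>2 * k Q"
      by (simp add: G_def k_def sum.distrib sum_distrib_left)
    finally show ?thesis .
  qed
  have k_small: "(\<lambda>Q. (k Q)\<^sup>2 / real (N Q)) \<longlonglongrightarrow> 0"
    if "filterlim (\<lambda>Q. real (N Q)) at_top sequentially"
  proof (rule tendstoI)
    fix e :: real assume e: "e > 0"
    obtain K where K: "\<And>Q A. A \<subseteq> {p. prime p \<and> p \<le> Q} \<Longrightarrow>
      (real (card A))\<^sup>2 \<le> e / 2 * real (card (prime_fractions Q A P)) + K"
      using card_squared_le_card_prime_fractions[OF assms(2) D, of "e / 2"] e by auto
    \<comment> \<open>The threshold \<open>4 * K / e\<close> makes the constant \<open>K\<close> at
      most a quarter of \<open>e * N\<close>, leaving room for the strict inequality.\<close>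
    have "\<forall>\<^sub>F Q in sequentially. max 1 (4 * K / e) \<le> real (N Q)"
      using that unfolding filterlim_at_top by blast
    thus "\<forall>\<^sub>F Q in sequentially. dist ((k Q)\<^sup>2 / real (N Q)) 0 < e"
    proof eventually_elim
      case (elim Q)
      have "(k Q)\<^sup>2 \<le> e / 2 * real (N Q) + K" using K[OF assms(3)] by (simp add: k_def N_def)
      moreover have "4 * K \<le> e * real (N Q)" using elim e by (simp add: divide_le_eq mult.commute)
      moreover have "e * real (N Q) > 0" using elim e by simp
      ultimately have "(k Q)\<^sup>2 < e * real (N Q)" by linarith
      thus ?case using elim by (simp add: divide_less_eq)
    qed
  qed
  show ?thesis
  proof
    assume o: "(\<lambda>Q. \<Sum>p\<in>B Q. (real p)\<^sup>2)
      \<in> o[sequentially](\<lambda>Q. (real (card (prime_fractions Q (B Q) P)))\<^sup>2)"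
    hence SN: "(\<lambda>Q. S Q / (real (N Q))\<^sup>2) \<longlonglongrightarrow> 0"
      unfolding S_def N_def by (rule smalloD_tendsto)
    have top: "filterlim (\<lambda>Q. real (N Q)) at_top sequentially"
      unfolding filterlim_at_top
    proof
      fix Z :: real
      define Y where "Y = max Z 1"
      have Y: "Y \<ge> 1" "Z \<le> Y" by (auto simp: Y_def)
      have "\<forall>\<^sub>F Q in sequentially. norm (S Q) \<le> 1 / Y\<^sup>2 * norm ((real (N Q))\<^sup>2)"
        using o Y unfolding S_def N_def by (intro landau_o.smallD) auto
      thus "\<forall>\<^sub>F Q in sequentially. Z \<le> real (N Q)" using assms(4)
      proof eventually_elim
        case (elim Q)
        then obtain p where p: "p \<in> B Q" by auto
        \<comment> \<open>A single denominator already makes \<open>S Q\<close> at least 1, so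
          \<open>S = o(N^2)\<close> can hold only if \<open>N\<close> tends to infinity.\<close>
        have "1 \<le> (real p)\<^sup>2" using posB[OF p] by simp
        also have "\<dots> \<le> S Q" unfolding S_def by (intro member_le_sum p finB) auto
        also have "\<dots> \<le> 1 / Y\<^sup>2 * (real (N Q))\<^sup>2" using elim by simp
        finally have "Y\<^sup>2 \<le> (real (N Q))\<^sup>2" using Y by (simp add: le_divide_eq)
        hence "Y \<le> real (N Q)" by (rule power2_le_imp_le) simp
        thus ?case using Y by simp
      qed
    qed
    show "poissonian_pair_corr (\<lambda>Q. prime_fractions Q (B Q) P)"
      unfolding poissonian_pair_corr_def pc_def[symmetric]
    proof (intro allI impI)
      fix \<Lambda> :: real assume \<Lambda>: "\<Lambda> > 0"
      \<comment> \<open>This gives \<open>N > 0\<close> and window length at most 1. In the bound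
        below, one summand \<open>\<Lambda> * S / N^2\<close> pays for the missing diagonal main
        terms and one for the actual equal-denominator pairs.\<close>
      have "\<forall>\<^sub>F Q in sequentially. max \<Lambda> 1 \<le> real (N Q)"
        using top unfolding filterlim_at_top by blast
      hence bound: "\<forall>\<^sub>F Q in sequentially.
        norm (pc Q \<Lambda> - \<Lambda>) \<le> 2 * \<Lambda> * (S Q / (real (N Q))\<^sup>2) + E * ((k Q)\<^sup>2 / real (N Q))"
      proof eventually_elim
        case (elim Q)
        define \<delta> where "\<delta> = \<Lambda> / real (N Q)"
        define T where "T = (\<Sum>p\<in>B Q. window_count P \<delta> p p)"
        have \<delta>: "0 < \<delta>" "\<delta> \<le> 1" using elim \<Lambda> by (auto simp: \<delta>_def)
        have "0 \<le> T" unfolding T_def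
          by (intro sum_nonneg window_count_same_prime(1)[OF posB \<delta>])
        moreover have "T \<le> (\<Sum>p\<in>B Q. \<delta> * (real p)\<^sup>2)" unfolding T_def
          by (intro sum_mono window_count_same_prime(2)[OF posB \<delta>])
        hence "T \<le> \<delta> * S Q" by (simp add: S_def sum_distrib_left)
        hence "T / real (N Q) \<le> \<delta> * S Q / real (N Q)" by (intro divide_right_mono) auto
        moreover have "\<delta> * S Q / real (N Q) = \<Lambda> * (S Q / (real (N Q))\<^sup>2)"
          by (simp add: \<delta>_def power2_eq_square)
        ultimately have T: "0 \<le> T / real (N Q)" "T / real (N Q) \<le> \<Lambda> * (S Q / (real (N Q))\<^sup>2)" by auto
        have G: "0 \<le> \<Lambda> * G Q / (real (N Q))\<^sup>2" using GS[of Q] \<Lambda> by simp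
        have "\<Lambda> * G Q / (real (N Q))\<^sup>2 \<le> \<Lambda> * S Q / (real (N Q))\<^sup>2"
          using GS[of Q] \<Lambda> by (intro divide_right_mono mult_left_mono) auto
        moreover have "\<bar>pc Q \<Lambda> - \<Lambda> + \<Lambda> * G Q / (real (N Q))\<^sup>2 - T / real (N Q)\<bar> \<le> E * (k Q)\<^sup>2 / real (N Q)"
          unfolding T_def \<delta>_def by (rule approx) (use elim \<Lambda> in auto)
        ultimately show ?case using T G unfolding real_norm_def by (simp add: abs_le_iff)
      qed
      have "(\<lambda>Q. 2 * \<Lambda> * (S Q / (real (N Q))\<^sup>2) + E * ((k Q)\<^sup>2 / real (N Q))) \<longlonglongrightarrow> 2 * \<Lambda> * 0 + E * 0"
        by (intro tendsto_intros SN k_small top)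
      hence "(\<lambda>Q. pc Q \<Lambda> - \<Lambda>) \<longlonglongrightarrow> 0" by (intro real_tendsto_zero_comparison[OF bound]) simp
      thus "(\<lambda>Q. pc Q \<Lambda>) \<longlonglongrightarrow> \<Lambda>" by (rule LIM_zero_cancel)
    qed
  next
    assume poisson: "poissonian_pair_corr (\<lambda>Q. prime_fractions Q (B Q) P)"
    hence top: "filterlim (\<lambda>Q. real (N Q)) at_top sequentially"
      unfolding N_def by (rule poissonian_pair_corr_imp_card_at_top)
    have "(\<lambda>Q. pc Q (1 / 2)) \<longlonglongrightarrow> 1 / 2"
      using poisson by (simp add: poissonian_pair_corr_def pc_def)
    hence pc0: "(\<lambda>Q. \<bar>pc Q (1 / 2) - 1 / 2\<bar>) \<longlonglongrightarrow> 0" by (intro tendsto_rabs_zero LIM_zero)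
    have ev: "\<forall>\<^sub>F Q in sequentially. max (real D) 1 \<le> real (N Q)"
      using top unfolding filterlim_at_top by blast
    hence bound: "\<forall>\<^sub>F Q in sequentially. norm (S Q / (real (N Q))\<^sup>2)
      \<le> 4 * \<bar>pc Q (1 / 2) - 1 / 2\<bar> + (4 * E + 2 * (real D)\<^sup>2) * ((k Q)\<^sup>2 / real (N Q))"
    proof eventually_elim
      case (elim Q)
      have N: "real (N Q) \<ge> 1" "real D \<le> real (N Q)" "N Q > 0" using elim by auto
      \<comment> \<open>Here \<open>\<Lambda> = 1 / 2\<close> is decisive: \<open>p\<close> is at
        most \<open>N + D\<close>, hence at most \<open>2 * N\<close>, so the window of length
        \<open>1 / (2 * N)\<close> does not exceed the grid spacing \<open>1 / p\<close>. Only the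
        missing diagonal main terms remain, and convergence to \<open>1 / 2\<close> forces them to
        vanish in the limit.\<close>
      have "window_count P (1 / 2 / real (N Q)) p p = 0" if p: "p \<in> B Q" for p
      proof (rule window_count_same_prime(3))
        have "p \<le> card (nonroots P p) + D" using card_nonroots[of P p] D[of p] assms(3)[of Q] p by auto
        moreover have "card (nonroots P p) \<le> N Q"
          unfolding N_def card_prime_fractions[OF assms(2,3)] by (intro member_le_sum p finB) auto
        ultimately have "real p \<le> 2 * real (N Q)" using N by linarith
        thus "real p * (1 / 2 / real (N Q)) \<le> 1" using N by (simp add: divide_le_eq)
      qed (use N posB[OF p] in \<open>auto simp: divide_le_eq\<close>)
      hence "\<bar>pc Q (1 / 2) - 1 / 2 + 1 / 2 * G Q / (real (N Q))\<^sup>2\<bar> \<le> E * (k Q)\<^sup>2 / real (N Q)"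
        using approx[of Q "1 / 2"] N by simp
      hence "pc Q (1 / 2) - 1 / 2 + 1 / 2 * (G Q / (real (N Q))\<^sup>2) \<le> E * ((k Q)\<^sup>2 / real (N Q))"
        unfolding times_divide_eq_right by (rule abs_le_D1)
      moreover have "g \<le> 2 * \<bar>x\<bar> + 2 * y" if "x + 1 / 2 * g \<le> y" for g x y :: real
        using that by linarith
      ultimately have G: "G Q / (real (N Q))\<^sup>2
          \<le> 2 * \<bar>pc Q (1 / 2) - 1 / 2\<bar> + 2 * (E * ((k Q)\<^sup>2 / real (N Q)))"
        by blast
      \<comment> \<open>Together with \<open>N \<le> N^2\<close> this bounds the leftover
        \<open>k / N^2\<close> by \<open>k^2 / N\<close>, which is already known to tend to
        0.\<close>
      have "k Q \<le> (k Q)\<^sup>2" by (cases "card (B Q)") (auto simp: k_def power2_eq_square)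
      moreover have "real (N Q) \<le> (real (N Q))\<^sup>2" using N by (simp add: power2_eq_square)
      ultimately have "k Q / (real (N Q))\<^sup>2 \<le> (k Q)\<^sup>2 / real (N Q)"
        using N by (intro frac_le) (auto simp: k_def)
      hence kN: "2 * (real D)\<^sup>2 * (k Q / (real (N Q))\<^sup>2) \<le> 2 * (real D)\<^sup>2 * ((k Q)\<^sup>2 / real (N Q))"
        by (intro mult_left_mono) auto
      have "S Q / (real (N Q))\<^sup>2 \<le> (2 * G Q + 2 * (real D)\<^sup>2 * k Q) / (real (N Q))\<^sup>2"
        using SG by (intro divide_right_mono) auto
      also have "\<dots> = 2 * (G Q / (real (N Q))\<^sup>2) + 2 * (real D)\<^sup>2 * (k Q / (real (N Q))\<^sup>2)"
        by (simp add: add_divide_distrib)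
      finally have "S Q / (real (N Q))\<^sup>2 \<le> 4 * \<bar>pc Q (1 / 2) - 1 / 2\<bar>
          + (4 * E + 2 * (real D)\<^sup>2) * ((k Q)\<^sup>2 / real (N Q))"
        using G kN unfolding distrib_right by linarith
      moreover have "0 \<le> S Q / (real (N Q))\<^sup>2" using GS[of Q] by simp
      ultimately show ?case unfolding real_norm_def by linarith
    qed
    have "(\<lambda>Q. 4 * \<bar>pc Q (1 / 2) - 1 / 2\<bar> + (4 * E + 2 * (real D)\<^sup>2) * ((k Q)\<^sup>2 / real (N Q)))
        \<longlonglongrightarrow> 4 * 0 + (4 * E + 2 * (real D)\<^sup>2) * 0"
      by (intro tendsto_intros pc0 k_small top)
    hence "(\<lambda>Q. S Q / (real (N Q))\<^sup>2) \<longlonglongrightarrow> 0" by (intro real_tendsto_zero_comparison[OF bound]) simp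
    moreover have "\<forall>\<^sub>F Q in sequentially. (real (N Q))\<^sup>2 \<noteq> 0"
      using ev by eventually_elim auto
    ultimately show "(\<lambda>Q. \<Sum>p\<in>B Q. (real p)\<^sup>2)
      \<in> o[sequentially](\<lambda>Q. (real (card (prime_fractions Q (B Q) P)))\<^sup>2)"
      unfolding S_def N_def by (rule smalloI_tendsto)
  qed
qed

end
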